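(* Let $1<r<R$. Assume that $u$ is analytic in the annulus $R^{-1}\leqslant |z|\leqslant R$ and that $K$ is analytic in the smaller annulus $r^{-1}\leqslant |z|\leqslant r$. Let $K_n$ be the $n$th order Laurent expansion of $K$ (with halved extreme terms), let $T_{2n}$ be the $2n$-point trapezoidal rule on the unit circle, and let $I(Ku)=\int_{|z|=1}K(z)u(z)\frac{dz}{iz}$. Then $$T_{2n}(K_nu)-I(Ku)=O\big((Rr)^{-n}\big),\qquad n\to\infty .$$
   Context: The circle $|z|=1$ is traversed once counterclockwise. For a function $v$ on the unit circle, $I(v)=\int_0^{2\pi}v(e^{it})\,dt=\int_{|z|=1}v(z)\frac{dz}{iz}$, and for a positive integer $m$ the trapezoidal rule is $T_m(v)=\frac{2\pi}{m}\sum_{k=1}^m v(e^{2\pi i k/m})$; thus $T_{2n}(K_nu)=\frac{\pi}{n}\sum_{k=1}^{2n}K_n(e^{\pi i k/n})\,u(e^{\pi i k/n})$. The $n$th order Laurent expansion of $K$ is $$K_n(z)=\tfrac12 c_{-n}z^{-n}+\sum_{k=-n+1}^{n-1}c_kz^k+\tfrac12 c_nz^n,\qquad c_k=\frac1{2\pi i}\int_{|z|=1}K(z)z^{-k-1}\,dz .$$ "Analytic in a closed annulus" means analytic in an open neighborhood of it. The functions $u,K$ and the numbers $r,R$ are fixed as $n\to\infty$. *)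

theory Defs
  imports "HOL-Complex_Analysis.Complex_Analysis" "HOL-Library.Landau_Symbols"
begin

definition annulus :: "real \<Rightarrow> complex set" where
  "annulus \<rho> = {z. inverse \<rho> \<le> norm z \<and> norm z \<le> \<rho>}"

definition circle_int :: "(complex \<Rightarrow> complex) \<Rightarrow> complex" where
  "circle_int v = contour_integral (circlepath 0 1) (\<lambda>z. v z / (\<i> * z))"

definition trapezoid :: "nat \<Rightarrow> (complex \<Rightarrow> complex) \<Rightarrow> complex" where
  "trapezoid m v =
     complex_of_real (2 * pi / real m) *
     (\<Sum>k=1..m. v (exp (2 * complex_of_real pi * \<i> * of_nat k / of_nat m)))"

definition laurent_coeff :: "(complex \<Rightarrow> complex) \<Rightarrow> int \<Rightarrow> complex" where
  "laurent_coeff K k =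
     1 / (2 * complex_of_real pi * \<i>) *
     contour_integral (circlepath 0 1) (\<lambda>z. K z * z powi (- k - 1))"

definition halved_laurent_sum :: "(complex \<Rightarrow> complex) \<Rightarrow> nat \<Rightarrow> complex \<Rightarrow> complex" where
  "halved_laurent_sum K n z =
     1 / 2 * laurent_coeff K (- int n) * z powi (- int n)
     + (\<Sum>k = - int n + 1..int n - 1. laurent_coeff K k * z powi k)
     + 1 / 2 * laurent_coeff K (int n) * z powi (int n)"

end

theory Submission
  imports Defs
begin

text \<open>
  The error splits as \<open>(T - I)(K\<^sub>n u) + I((K\<^sub>n - K) u)\<close>. Moving the contour to \<open>|z| = R\<close> and
  \<open>|z| = 1/R\<close> makes the aliasing error of the \<open>m\<close>-point rule at most a multiple of
  \<open>R\<^sup>-\<^sup>m\<close> times the maximum of the integrand there, and \<open>K\<^sub>n\<close> has size \<open>O((R/r)\<^sup>n)\<close> on both circles, outside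
  the domain of \<open>K\<close>; with \<open>m = 2n\<close> this gives \<open>(R/r)\<^sup>n R\<^sup>-\<^sup>2\<^sup>n = (R r)\<^sup>-\<^sup>n\<close>.
  In the second term, \<open>K - K\<^sub>n\<close> is on the unit circle a sum of a function holomorphic in \<open>|z| < r\<close> with
  a zero of order \<open>n\<close> at the origin, and one holomorphic in \<open>|z| > 1/r\<close> with a zero of order \<open>n\<close> at
  infinity, both with a factor \<open>r\<^sup>-\<^sup>n\<close>. Integrating the first against \<open>u\<close> over \<open>|z| = 1/R\<close> and the second
  over \<open>|z| = R\<close> gains the factor \<open>R\<^sup>-\<^sup>n\<close>.
\<close>

section \<open>Integrals over circles about the origin\<close>

lemma has_contour_integral_circlepath:
  assumes "0 < \<rho>" and "continuous_on (sphere 0 \<rho>) f"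
  shows "(f has_contour_integral contour_integral (circlepath 0 \<rho>) f) (circlepath 0 \<rho>)"
  using assms by (intro has_contour_integral_integral contour_integrable_continuous_circlepath) simp

lemma norm_contour_integral_circlepath_le:
  assumes "0 < \<rho>" and "continuous_on (sphere 0 \<rho>) f"
    and "\<And>z. norm z = \<rho> \<Longrightarrow> norm (f z) \<le> B"
  shows "norm (contour_integral (circlepath 0 \<rho>) f) \<le> B * (2 * pi * \<rho>)"
proof -
  \<comment> \<open>The standard estimate asks for \<open>0 \<le> B\<close>; the point
    \<open>\<rho>\<close> of the circle supplies it.\<close>
  have "0 \<le> norm (f (of_real \<rho>))" by simp
  also have "\<dots> \<le> B" using assms(1) by (intro assms(3)) simp
  finally show ?thesis
    using has_contour_integral_bound_circlepath[OF has_contour_integral_circlepath[OF assms(1,2)], of B]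
      assms(1,3) by simp
qed

text \<open>The straight-line homotopy moves each point radially to the point of the same argument
  on the other circle, so it stays in the closed annulus between the circles.\<close>

lemma contour_integral_circlepath_deform:
  assumes "open S" and "f holomorphic_on S" and "0 < a" and "a \<le> b"
    and sub: "\<And>z. a \<le> norm z \<Longrightarrow> norm z \<le> b \<Longrightarrow> z \<in> S"
  shows "contour_integral (circlepath 0 a) f = contour_integral (circlepath 0 b) f"
proof (rule Cauchy_theorem_homotopic_loops[OF homotopic_loops_linear assms(1,2)])
  fix t :: real
  define e where "e = exp (2 * of_real pi * \<i> * of_real t)"
  have e: "norm e = 1" by (simp add: e_def)
  show "closed_segment (circlepath 0 a t) (circlepath 0 b t) \<subseteq> S"
  proof
    fix z assume "z \<in> closed_segment (circlepath 0 a t) (circlepath 0 b t)"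
    then obtain s where s: "0 \<le> s" "s \<le> 1"
      and z: "z = (1 - s) *\<^sub>R (a * e) + s *\<^sub>R (b * e)"
      by (auto simp: closed_segment_def circlepath e_def)
    have "z = of_real ((1 - s) * a + s * b) * e"
      by (simp add: z scaleR_conv_of_real algebra_simps)
    moreover have ab: "a \<le> (1 - s) * a + s * b" "(1 - s) * a + s * b \<le> b"
      using s assms(4) mult_left_mono[of a b s] mult_left_mono[of a b "1 - s"]
      by (simp_all add: algebra_simps)
    ultimately have "norm z = (1 - s) * a + s * b"
      using e assms(3) by (simp add: norm_mult del: of_real_add of_real_mult)
    with ab show "z \<in> S" by (intro sub) auto
  qed
qed (simp_all add: valid_path_imp_path)

section \<open>Cauchy transforms of functions on a circle\<close>

text \<open>Only the values of \<open>g\<close> on the circle enter. The same formula serves both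
  sides: over the outer circle of an annulus it yields the part of the Laurent series with
  nonnegative powers, over the inner circle minus the part with negative powers.\<close>

definition cauchy_transform :: "real \<Rightarrow> (complex \<Rightarrow> complex) \<Rightarrow> complex \<Rightarrow> complex" where
  "cauchy_transform \<rho> g w =
     contour_integral (circlepath 0 \<rho>) (\<lambda>z. g z / (z - w)) / (2 * of_real pi * \<i>)"

text \<open>Differentiation under the integral sign works at every point off the circle, inside and
  outside, and asks only for continuity of \<open>g\<close>.\<close>

lemma cauchy_transform_holomorphic:
  assumes "0 < \<rho>" and "continuous_on (sphere 0 \<rho>) g"
  shows "cauchy_transform \<rho> g holomorphic_on - sphere 0 \<rho>"
proof -
  define F where "F w = contour_integral (circlepath 0 \<rho>) (\<lambda>z. g z / (z - w))" for w
  have "\<exists>D. (F has_field_derivative D) (at w)" if "w \<in> - sphere 0 \<rho>" for w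
  proof -
    have "(F has_field_derivative
            (of_nat 1 * contour_integral (circlepath 0 \<rho>) (\<lambda>u. g u / (u - w) ^ Suc 1))) (at w)"
    \<comment> \<open>The bound \<open>2 * pi * \<rho>\<close> is the constant speed of the
      parametrized circle.\<close>
    proof (rule Cauchy_next_derivative(2)[where S = UNIV and B = "2 * pi * \<rho>"])
      fix v assume "v \<in> UNIV - path_image (circlepath 0 \<rho>)"
      then have "continuous_on (sphere 0 \<rho>) (\<lambda>u. g u / (u - v) ^ 1)"
        using assms by (auto intro!: continuous_intros)
      then show "((\<lambda>u. g u / (u - v) ^ 1) has_contour_integral F v) (circlepath 0 \<rho>)"
        using has_contour_integral_circlepath[OF assms(1)] by (force simp: F_def)
    qed (use assms that in \<open>auto simp: vector_derivative_circlepath norm_mult\<close>)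
    then show ?thesis by blast
  qed
  then have "F holomorphic_on - sphere 0 \<rho>"
    by (auto simp: holomorphic_on_open open_Compl)
  moreover have "cauchy_transform \<rho> g = (\<lambda>w. F w / (2 * of_real pi * \<i>))"
    by (simp add: fun_eq_iff F_def cauchy_transform_def)
  ultimately show ?thesis by (auto intro!: holomorphic_intros)
qed

lemma norm_cauchy_transform_le:
  assumes "0 < \<rho>" and "continuous_on (sphere 0 \<rho>) g"
    and B: "\<And>z. norm z = \<rho> \<Longrightarrow> norm (g z) \<le> B"
    and "norm w \<noteq> \<rho>"
  shows "norm (cauchy_transform \<rho> g w) \<le> \<rho> * B / \<bar>norm w - \<rho>\<bar>"
proof -
  have "norm (contour_integral (circlepath 0 \<rho>) (\<lambda>z. g z / (z - w)))
          \<le> B / \<bar>norm w - \<rho>\<bar> * (2 * pi * \<rho>)"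
  proof (rule norm_contour_integral_circlepath_le[OF assms(1)])
    show "continuous_on (sphere 0 \<rho>) (\<lambda>z. g z / (z - w))"
      using assms by (auto intro!: continuous_intros)
    fix z :: complex assume z: "norm z = \<rho>"
    have "\<bar>norm w - \<rho>\<bar> \<le> norm (z - w)"
      using z norm_triangle_ineq3[of z w] by simp
    moreover have "0 \<le> B" using B[OF z] norm_ge_zero order_trans by blast
    ultimately show "norm (g z / (z - w)) \<le> B / \<bar>norm w - \<rho>\<bar>"
      using B[OF z] assms(4) by (auto simp: norm_divide intro!: frac_le)
  qed
  then show ?thesis
    by (simp add: cauchy_transform_def norm_divide norm_mult field_simps)
qed

text \<open>The difference quotient \<open>h\<close> has a removable singularity at
  \<open>w\<close>, so its integrals over the two circles agree. What remains is \<open>f w\<close>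
  times the difference of the winding numbers, 1 for the outer circle and 0 for the inner
  one.\<close>

lemma cauchy_formula_annulus:
  assumes "open S" and "f holomorphic_on S" and "0 < a"
    and sub: "\<And>z. a \<le> norm z \<Longrightarrow> norm z \<le> b \<Longrightarrow> z \<in> S"
    and w: "a < norm w" "norm w < b"
  shows "f w = cauchy_transform b f w - cauchy_transform a f w"
proof -
  define h where "h z = (if z = w then deriv f w else (f z - f w) / (z - w))" for z
  have "w \<in> S" using w by (intro sub) auto
  then have h: "h holomorphic_on S"
    unfolding h_def using pole_lemma[OF assms(2), of w] assms(1) by (simp add: interior_open)
  have eq: "contour_integral (circlepath 0 a) h = contour_integral (circlepath 0 b) h"
    using assms by (intro contour_integral_circlepath_deform[OF assms(1) h]) auto
  have hc: "contour_integral (circlepath 0 \<rho>) (\<lambda>z. f z / (z - w)) =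
          contour_integral (circlepath 0 \<rho>) h
            + f w * (2 * of_real pi * \<i> * winding_number (circlepath 0 \<rho>) w)"
    if "\<rho> \<in> {a, b}" for \<rho>
  proof (rule contour_integral_unique, rule has_contour_integral_eq)
    have \<rho>: "0 < \<rho>" "sphere 0 \<rho> \<subseteq> S" "norm w \<noteq> \<rho>" using that assms(3) w sub by auto
    have "((\<lambda>z. 1 / (z - w)) has_contour_integral
        2 * of_real pi * \<i> * winding_number (circlepath 0 \<rho>) w) (circlepath 0 \<rho>)"
      using \<rho> has_contour_integral_winding_number[of "circlepath 0 \<rho>" w] by simp
    then show "((\<lambda>z. h z + f w * (1 / (z - w))) has_contour_integral
       contour_integral (circlepath 0 \<rho>) h
            + f w * (2 * of_real pi * \<i> * winding_number (circlepath 0 \<rho>) w)) (circlepath 0 \<rho>)"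
      using \<rho> by (intro has_contour_integral_add has_contour_integral_lmul
          has_contour_integral_circlepath
          continuous_on_subset[OF holomorphic_on_imp_continuous_on[OF h]]) auto
    show "h z + f w * (1 / (z - w)) = f z / (z - w)" if "z \<in> path_image (circlepath 0 \<rho>)" for z
      using that \<rho> by (auto simp: h_def add_divide_distrib[symmetric])
  qed
  have "winding_number (circlepath 0 b) w = 1"
    using w by (intro winding_number_circlepath) simp
  moreover have "winding_number (circlepath 0 a) w = 0"
    using w assms(3)
    by (intro winding_number_zero_outside[where s = "cball 0 a"]) (auto simp: valid_path_imp_path)
  ultimately show ?thesis
    using hc[of a] hc[of b] eq by (simp add: cauchy_transform_def field_simps)
qed

section \<open>Finite geometric expansions of the Cauchy kernel\<close>

text \<open>A finite geometric series with its exact remainder. Being pure algebra, it needs no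
  comparison of the sizes of \<open>x\<close> and \<open>y\<close>.\<close>

lemma inverse_diff_expansion:
  fixes x y :: "'a :: field"
  assumes "x \<noteq> 0" and "x \<noteq> y"
  shows "1 / (x - y) = (\<Sum>j<n. y ^ j / x ^ Suc j) + y ^ n / x ^ n / (x - y)"
proof (induction n)
  case 0
  show ?case by simp
next
  case (Suc n)
  have "y ^ n / x ^ n / (x - y) = y ^ n / x ^ Suc n + y ^ Suc n / x ^ Suc n / (x - y)"
    using assms by (simp add: divide_simps) (simp add: algebra_simps)
  with Suc.IH show ?case by simp
qed

text \<open>The kernel is expanded in powers of \<open>w / z\<close> and integrated termwise. The
  remainder stays an exact Cauchy transform, so it can later be continued to other radii.\<close>

lemma cauchy_transform_expansion_inside:
  assumes "0 < \<rho>" and g: "continuous_on (sphere 0 \<rho>) g" and "norm w \<noteq> \<rho>"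
  shows "cauchy_transform \<rho> g w =
     (\<Sum>j<n. contour_integral (circlepath 0 \<rho>) (\<lambda>z. g z / z ^ Suc j) / (2 * of_real pi * \<i>) * w ^ j)
       + w ^ n * cauchy_transform \<rho> (\<lambda>z. g z / z ^ n) w"
proof -
  let ?C = "circlepath 0 \<rho>"
  have "contour_integral ?C (\<lambda>z. g z / (z - w)) =
     (\<Sum>j<n. w ^ j * contour_integral ?C (\<lambda>z. g z / z ^ Suc j))
       + w ^ n * contour_integral ?C (\<lambda>z. g z / z ^ n / (z - w))"
  proof (rule contour_integral_unique, rule has_contour_integral_eq)
    show "((\<lambda>z. (\<Sum>j<n. w ^ j * (g z / z ^ Suc j)) + w ^ n * (g z / z ^ n / (z - w)))
        has_contour_integral
          (\<Sum>j<n. w ^ j * contour_integral ?C (\<lambda>z. g z / z ^ Suc j))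
             + w ^ n * contour_integral ?C (\<lambda>z. g z / z ^ n / (z - w))) ?C"
      using assms by (intro has_contour_integral_add has_contour_integral_sum
          has_contour_integral_lmul has_contour_integral_circlepath)
        (auto intro!: continuous_intros)
    show "(\<Sum>j<n. w ^ j * (g z / z ^ Suc j)) + w ^ n * (g z / z ^ n / (z - w)) = g z / (z - w)"
      if "z \<in> path_image ?C" for z
    proof -
      have "z \<noteq> 0" "z \<noteq> w" using that assms by auto
      from inverse_diff_expansion[OF this, of n]
      have "g z * (1 / (z - w)) = g z * ((\<Sum>j<n. w ^ j / z ^ Suc j) + w ^ n / z ^ n / (z - w))"
        by simp
      then show ?thesis by (simp add: distrib_left sum_distrib_left mult_ac)
    qed
  qed
  then show ?thesis
    by (simp add: cauchy_transform_def add_divide_distrib sum_divide_distrib mult_ac)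
qed

text \<open>The counterpart in powers of \<open>z / w\<close>. The leading minus sign turns
  \<open>1 / (z - w)\<close> into \<open>1 / (w - z)\<close> and matches the sign of the inner
  circle in \<open>cauchy_formula_annulus\<close>.\<close>

lemma cauchy_transform_expansion_outside:
  assumes "0 < \<rho>" and g: "continuous_on (sphere 0 \<rho>) g" and "norm w \<noteq> \<rho>" and "w \<noteq> 0"
  shows "- cauchy_transform \<rho> g w =
     (\<Sum>j<n. contour_integral (circlepath 0 \<rho>) (\<lambda>z. g z * z ^ j) / (2 * of_real pi * \<i>) / w ^ Suc j)
       - cauchy_transform \<rho> (\<lambda>z. g z * z ^ n) w / w ^ n"
proof -
  let ?C = "circlepath 0 \<rho>"
  have "contour_integral ?C (\<lambda>z. g z / (z - w)) =
     (\<Sum>j<n. (- 1 / w ^ Suc j) * contour_integral ?C (\<lambda>z. g z * z ^ j))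
       + (1 / w ^ n) * contour_integral ?C (\<lambda>z. g z * z ^ n / (z - w))"
  proof (rule contour_integral_unique, rule has_contour_integral_eq)
    show "((\<lambda>z. (\<Sum>j<n. (- 1 / w ^ Suc j) * (g z * z ^ j)) + (1 / w ^ n) * (g z * z ^ n / (z - w)))
        has_contour_integral
          (\<Sum>j<n. (- 1 / w ^ Suc j) * contour_integral ?C (\<lambda>z. g z * z ^ j))
             + (1 / w ^ n) * contour_integral ?C (\<lambda>z. g z * z ^ n / (z - w))) ?C"
      using assms by (intro has_contour_integral_add has_contour_integral_sum
          has_contour_integral_lmul has_contour_integral_circlepath)
        (auto intro!: continuous_intros)
    show "(\<Sum>j<n. (- 1 / w ^ Suc j) * (g z * z ^ j)) + (1 / w ^ n) * (g z * z ^ n / (z - w)) = g z / (z - w)"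
      if "z \<in> path_image ?C" for z
    proof -
      have "w \<noteq> z" using that assms by auto
      from inverse_diff_expansion[OF assms(4) this, of n]
      have "- g z * (1 / (w - z)) = - g z * ((\<Sum>j<n. z ^ j / w ^ Suc j) + z ^ n / w ^ n / (w - z))"
        by simp
      moreover have "- g z * (1 / (w - z)) = g z / (z - w)"
        by (metis minus_diff_eq minus_divide_right mult.right_neutral mult_minus_left
            times_divide_eq_right minus_divide_left)
      moreover have "- g z * (z ^ n / w ^ n / (w - z)) = (1 / w ^ n) * (g z * z ^ n / (z - w))"
        using \<open>w \<noteq> z\<close> assms(4) by (simp add: divide_simps) (simp add: algebra_simps)
      moreover have "- g z * (\<Sum>j<n. z ^ j / w ^ Suc j) = (\<Sum>j<n. (- 1 / w ^ Suc j) * (g z * z ^ j))"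
        by (simp add: sum_distrib_left sum_negf mult_ac)
      ultimately show ?thesis by (metis distrib_left)
    qed
  qed
  then show ?thesis
    by (simp add: cauchy_transform_def diff_divide_distrib sum_divide_distrib sum_negf mult_ac)
qed

section \<open>The aliasing error of the trapezoidal rule\<close>

text \<open>For fixed \<open>j\<close> the summands are the powers of a single \<open>m\<close>-th
  root of unity \<open>\<omega>\<close>, so the geometric sum vanishes unless
  \<open>\<omega> = 1\<close>.\<close>

lemma sum_powers_root_of_unity:
  assumes "0 < m"
  shows "(\<Sum>k=1..m. exp (2 * of_real pi * \<i> * of_nat k / of_nat m) ^ j) = (if m dvd j then of_nat m else 0)"
proof -
  define \<omega> where "\<omega> = exp (2 * of_real pi * \<i> * of_nat j / of_nat m)"
  have pow: "exp (2 * of_real pi * \<i> * of_nat k / of_nat m) ^ j = \<omega> ^ k" for k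
    by (simp add: \<omega>_def exp_of_nat_mult[symmetric] mult_ac)
  have 1: "\<omega> ^ m = 1" unfolding \<omega>_def using assms by (intro complex_root_unity) simp
  have "\<omega> = 1 \<longleftrightarrow> m dvd j" unfolding \<omega>_def using assms by (intro complex_root_unity_eq_1) simp
  moreover have "(\<Sum>k=1..m. \<omega> ^ k) = 0" if "\<omega> \<noteq> 1"
    using sum_gp_multiplied[of 1 m \<omega>] assms 1 that by simp
  ultimately show ?thesis unfolding pow by auto
qed

text \<open>The right side is the logarithmic derivative of \<open>z ^ m - 1\<close>. The proof
  expands each summand geometrically and lets the sum over the roots remove all powers but
  one.\<close>

lemma sum_inverse_diff_roots_of_unity:
  assumes "0 < m" and "z \<noteq> 0" and "norm z \<noteq> 1"
  shows "(\<Sum>k=1..m. 1 / (z - exp (2 * of_real pi * \<i> * of_nat k / of_nat m)))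
           = of_nat m * z ^ (m - 1) / (z ^ m - 1)"
proof -
  define w where "w k = exp (2 * of_real pi * \<i> * of_nat k / of_nat m)" for k
  have wm: "w k ^ m = 1" for k unfolding w_def using assms(1) by (intro complex_root_unity) simp
  have nw: "norm (w k) = 1" for k by (simp add: w_def)
  have ne: "z ^ m \<noteq> 1"
  proof
    assume "z ^ m = 1"
    then have "norm z ^ m = 1" by (metis norm_power norm_one)
    then show False using assms power_eq_imp_eq_base[of "norm z" m 1] by simp
  qed
  \<comment> \<open>Since \<open>w k ^ m = 1\<close>, the remainder after \<open>m\<close> terms is
    the expanded fraction itself divided by \<open>z ^ m\<close>, and it can be moved to the
    left.\<close>
  have *: "1 / (z - w k) * (1 - 1 / z ^ m) = (\<Sum>j<m. w k ^ j / z ^ Suc j)" for k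
  proof -
    have "z \<noteq> w k" using assms(3) nw by auto
    have "1 / (z - w k) * (1 - 1 / z ^ m) = 1 / (z - w k) - 1 / z ^ m / (z - w k)"
      by (simp add: right_diff_distrib mult.commute)
    with inverse_diff_expansion[OF assms(2) \<open>z \<noteq> w k\<close>, of m] show ?thesis
      by (simp add: wm)
  qed
  have "(\<Sum>k=1..m. 1 / (z - w k)) * (1 - 1 / z ^ m) = (\<Sum>k=1..m. \<Sum>j<m. w k ^ j / z ^ Suc j)"
    unfolding sum_distrib_right * ..
  also have "\<dots> = (\<Sum>j<m. (\<Sum>k=1..m. w k ^ j) / z ^ Suc j)"
    by (subst sum.swap) (simp add: sum_divide_distrib)
  \<comment> \<open>Among the exponents below \<open>m\<close> only 0 is divisible by
    \<open>m\<close>.\<close>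
  also have "\<dots> = (\<Sum>j<m. if j = 0 then of_nat m / z else 0)"
    unfolding w_def sum_powers_root_of_unity[OF assms(1)] by (rule sum.cong) (auto dest: dvd_imp_le)
  also have "\<dots> = of_nat m / z" using assms(1) by simp
  finally have "(\<Sum>k=1..m. 1 / (z - w k)) * (1 - 1 / z ^ m) = of_nat m / z" .
  moreover have D: "1 - 1 / z ^ m \<noteq> 0" using ne by (simp add: eq_divide_eq)
  ultimately have "(\<Sum>k=1..m. 1 / (z - w k)) = of_nat m / z / (1 - 1 / z ^ m)"
    by (simp only: nonzero_eq_divide_eq[OF D])
  also have "1 - 1 / z ^ m = (z ^ m - 1) / (z * z ^ (m - 1))"
  proof -
    have "z ^ m = z * z ^ (m - 1)" using assms(1) by (simp add: power_eq_if)
    then show ?thesis using assms(2) by (simp add: diff_divide_distrib flip: \<open>z ^ m = z * z ^ (m - 1)\<close>)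
  qed
  also have "of_nat m / z / ((z ^ m - 1) / (z * z ^ (m - 1))) = of_nat m * z ^ (m - 1) / (z ^ m - 1)"
    using assms(2) by simp
  finally show ?thesis by (simp add: w_def)
qed

text \<open>The finite sum over the nodes is taken under the integral, where it acts on the Cauchy
  kernel alone and is evaluated by \<open>sum_inverse_diff_roots_of_unity\<close>.\<close>

lemma trapezoid_cauchy_transform:
  assumes "0 < m" and "0 < \<rho>" and "\<rho> \<noteq> 1" and g: "continuous_on (sphere 0 \<rho>) g"
  shows "trapezoid m (cauchy_transform \<rho> g) =
     contour_integral (circlepath 0 \<rho>) (\<lambda>z. g z * z ^ (m - 1) / (z ^ m - 1)) / \<i>"
proof -
  define w where "w k = exp (2 * of_real pi * \<i> * of_nat k / of_nat m)" for k
  have nw: "norm (w k) = 1" for k by (simp add: w_def)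
  let ?C = "circlepath 0 \<rho>"
  have "contour_integral ?C (\<lambda>z. of_nat m * (g z * z ^ (m - 1) / (z ^ m - 1)))
      = (\<Sum>k=1..m. contour_integral ?C (\<lambda>z. g z / (z - w k)))"
  proof (rule contour_integral_unique, rule has_contour_integral_eq)
    show "((\<lambda>z. \<Sum>k=1..m. g z / (z - w k)) has_contour_integral
        (\<Sum>k=1..m. contour_integral ?C (\<lambda>z. g z / (z - w k)))) ?C"
      using assms nw by (intro has_contour_integral_sum has_contour_integral_circlepath)
        (auto intro!: continuous_intros)
    fix z assume "z \<in> path_image ?C"
    then have "z \<noteq> 0" "norm z \<noteq> 1" using assms by auto
    from sum_inverse_diff_roots_of_unity[OF assms(1) this]
    have "g z * (\<Sum>k=1..m. 1 / (z - w k)) = g z * (of_nat m * z ^ (m - 1) / (z ^ m - 1))"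
      by (simp add: w_def)
    then show "(\<Sum>k=1..m. g z / (z - w k)) = of_nat m * (g z * z ^ (m - 1) / (z ^ m - 1))"
      by (simp add: sum_distrib_left mult_ac)
  qed
  moreover have ne: "z ^ m \<noteq> 1" if "norm z = \<rho>" for z :: complex
  proof
    assume "z ^ m = 1"
    then have "norm z ^ m = 1" by (metis norm_power norm_one)
    then show False using assms that power_eq_imp_eq_base[of "norm z" m 1] by simp
  qed
  have "contour_integral ?C (\<lambda>z. of_nat m * (g z * z ^ (m - 1) / (z ^ m - 1)))
      = of_nat m * contour_integral ?C (\<lambda>z. g z * z ^ (m - 1) / (z ^ m - 1))"
    using assms ne
    by (intro contour_integral_unique has_contour_integral_lmul has_contour_integral_circlepath)
      (auto intro!: continuous_intros)
  ultimately have "(\<Sum>k=1..m. contour_integral ?C (\<lambda>z. g z / (z - w k)))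
      = of_nat m * contour_integral ?C (\<lambda>z. g z * z ^ (m - 1) / (z ^ m - 1))"
    by simp
  moreover have "trapezoid m (cauchy_transform \<rho> g) =
      of_real (2 * pi / real m) * (\<Sum>k=1..m. contour_integral ?C (\<lambda>z. g z / (z - w k)))
        / (2 * of_real pi * \<i>)"
    by (simp only: trapezoid_def cauchy_transform_def w_def sum_divide_distrib[symmetric] times_divide_eq_right)
  ultimately show ?thesis using assms(1) by simp
qed

text \<open>On the unit circle \<open>v\<close> is a difference of Cauchy transforms over the radii
  \<open>R\<close> and \<open>1 / R\<close>, so the rule becomes two integrals with kernel
  \<open>z ^ (m - 1) / (z ^ m - 1)\<close>. Subtracting the exact integral, moved to radius
  \<open>R\<close>, leaves a small kernel on both circles; each of them contributes half of the
  bound.\<close>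

lemma trapezoid_error_le:
  assumes "0 < m" and "1 < R" and "open S" and "v holomorphic_on S"
    and sub: "annulus R \<subseteq> S"
    and B: "\<And>z. norm z = R \<or> norm z = 1 / R \<Longrightarrow> norm (v z) \<le> B"
  shows "norm (trapezoid m v - circle_int v) \<le> 4 * pi * B / (R ^ m - 1)"
proof -
  let ?C = "circlepath 0 :: real \<Rightarrow> real \<Rightarrow> complex"
  have R: "0 < R" "R \<noteq> 1" "1 / R < 1" "1 / R \<noteq> 1" "0 < 1 / R" "1 / R \<le> R"
    using assms(2) by (auto simp: divide_simps less_1_mult order.strict_implies_order)
  have Rm: "1 < R ^ m" using assms(1,2) by (simp add: one_less_power)
  have sub': "z \<in> S" if "1 / R \<le> norm z" "norm z \<le> R" for z
    using sub that by (auto simp: annulus_def inverse_eq_divide)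
  have cont: "continuous_on (sphere 0 \<rho>) v" if "1 / R \<le> \<rho>" "\<rho> \<le> R" for \<rho>
    using that sub' by (intro continuous_on_subset[OF holomorphic_on_imp_continuous_on[OF assms(4)]]) auto
  have 0: "0 \<le> B" using order_trans[OF norm_ge_zero B[of "of_real R"]] R(1) by simp
  \<comment> \<open>The absolute value covers both radii: it is \<open>R ^ m - 1\<close> on the
    outer circle and \<open>1 - (1 / R) ^ m\<close> on the inner one.\<close>
  have ge: "\<bar>norm z ^ m - 1\<bar> \<le> norm (z ^ m - 1)" for z :: complex
    using norm_triangle_ineq3[of "z ^ m" 1] by (simp add: norm_power)
  have ne: "z ^ m \<noteq> 1" if "norm z = R \<or> norm z = 1 / R" for z :: complex
    using ge[of z] that Rm R by (auto simp: power_divide)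
  \<comment> \<open>The kernel here is \<open>z ^ (m - 1) / (z ^ m - 1) - 1 / z\<close>: the rule
    minus the exact integral.\<close>
  define outer where "outer z = v z / (z * (z ^ m - 1))" for z
  define inner where "inner z = v z * z ^ (m - 1) / (z ^ m - 1)" for z
  have cont_outer: "continuous_on (sphere 0 R) outer" and cont_inner: "continuous_on (sphere 0 (1 / R)) inner"
    unfolding outer_def inner_def using R ne by (auto intro!: continuous_intros cont)
  have roots: "v z = cauchy_transform R v z - cauchy_transform (1 / R) v z" if "norm z = 1" for z
    using assms R sub' that by (intro cauchy_formula_annulus[OF assms(3,4)]) auto
  have "trapezoid m v = trapezoid m (cauchy_transform R v) - trapezoid m (cauchy_transform (1 / R) v)"
    unfolding trapezoid_def right_diff_distrib[symmetric] sum_subtractf[symmetric]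
    by (intro arg_cong2[where f = "(*)"] sum.cong refl roots) simp
  also have "\<dots> = (contour_integral (?C R) (\<lambda>z. v z * z ^ (m - 1) / (z ^ m - 1)) - contour_integral (?C (1 / R)) inner) / \<i>"
    unfolding inner_def using R assms(1)
    by (simp add: trapezoid_cauchy_transform cont right_diff_distrib)
  finally have T: "trapezoid m v = \<dots>" .
  have sub1: "z \<in> S" if "1 \<le> norm z" "norm z \<le> R" for z
    using that R(3) by (intro sub') linarith+
  have "contour_integral (?C 1) (\<lambda>z. v z / (\<i> * z)) = contour_integral (?C R) (\<lambda>z. v z / (\<i> * z))"
    using assms(2,3) sub1
    by (intro contour_integral_circlepath_deform[where S = "S - {0}"])
      (auto intro!: holomorphic_intros holomorphic_on_subset[OF assms(4)])
  also have "\<dots> = contour_integral (?C R) (\<lambda>z. v z / z) / \<i>"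
  proof (rule contour_integral_unique, rule has_contour_integral_eq[OF has_contour_integral_div])
    show "((\<lambda>z. v z / z) has_contour_integral contour_integral (?C R) (\<lambda>z. v z / z)) (?C R)"
      using R by (intro has_contour_integral_circlepath) (auto intro!: continuous_intros cont)
  qed (simp only: divide_divide_eq_left mult.commute)
  finally have I: "circle_int v = \<dots>" unfolding circle_int_def .
  have O: "contour_integral (?C R) (\<lambda>z. v z * z ^ (m - 1) / (z ^ m - 1))
      = contour_integral (?C R) outer + contour_integral (?C R) (\<lambda>z. v z / z)"
  proof (rule contour_integral_unique, rule has_contour_integral_eq[OF has_contour_integral_add])
    show "(outer has_contour_integral contour_integral (?C R) outer) (?C R)"
      by (rule has_contour_integral_circlepath[OF R(1) cont_outer])
    show "((\<lambda>z. v z / z) has_contour_integral contour_integral (?C R) (\<lambda>z. v z / z)) (?C R)"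
      using R by (intro has_contour_integral_circlepath) (auto intro!: continuous_intros cont)
    fix z assume "z \<in> path_image (?C R)"
    then have "z \<noteq> 0" "z ^ m \<noteq> 1" using R ne by auto
    moreover have "z ^ m = z * z ^ (m - 1)" using assms(1) by (simp add: power_eq_if)
    ultimately show "outer z + v z / z = v z * z ^ (m - 1) / (z ^ m - 1)"
      unfolding outer_def by (simp add: divide_simps) (simp add: algebra_simps)
  qed
  have "norm (contour_integral (?C R) outer) \<le> B / (R * (R ^ m - 1)) * (2 * pi * R)"
  proof (rule norm_contour_integral_circlepath_le[OF R(1) cont_outer])
    fix z :: complex assume z: "norm z = R"
    then show "norm (outer z) \<le> B / (R * (R ^ m - 1))"
      unfolding outer_def norm_divide norm_mult using B ge[of z] Rm R 0
      by (intro frac_le mult_mono mult_pos_pos) auto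
  qed
  then have 1: "norm (contour_integral (?C R) outer) \<le> 2 * pi * B / (R ^ m - 1)"
    using R by (simp add: mult_ac)
  have "norm (contour_integral (?C (1 / R)) inner) \<le> B * R / (R ^ m - 1) * (2 * pi * (1 / R))"
  proof (rule norm_contour_integral_circlepath_le[OF R(5) cont_inner])
    fix z :: complex assume z: "norm z = 1 / R"
    have "norm (inner z) \<le> B * (1 / R) ^ (m - 1) / (1 - (1 / R) ^ m)"
      unfolding inner_def norm_divide norm_mult norm_power z using B[of z] ge[of z] Rm R 0 z
      by (intro frac_le mult_mono) (auto simp: power_divide)
    \<comment> \<open>Numerator and denominator are multiplied by \<open>R ^ m\<close>. The surplus
      factor \<open>R\<close> cancels against the length of the inner circle.\<close>
    also have "\<dots> = B * R / (R ^ m - 1)"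
      using R Rm assms(1) by (cases m) (simp_all add: field_simps)
    finally show "norm (inner z) \<le> B * R / (R ^ m - 1)" .
  qed
  then have 2: "norm (contour_integral (?C (1 / R)) inner) \<le> 2 * pi * B / (R ^ m - 1)"
    using R by (simp add: field_simps)
  have "trapezoid m v - circle_int v = (contour_integral (?C R) outer - contour_integral (?C (1 / R)) inner) / \<i>"
    unfolding T I O by (simp add: field_simps)
  then have "norm (trapezoid m v - circle_int v) = norm (contour_integral (?C R) outer - contour_integral (?C (1 / R)) inner)"
    by (simp add: norm_divide norm_mult)
  also have "\<dots> \<le> 2 * pi * B / (R ^ m - 1) + 2 * pi * B / (R ^ m - 1)"
    by (rule order_trans[OF norm_triangle_ineq4 add_mono[OF 1 2]])
  finally show ?thesis by (simp add: mult_ac)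
qed

section \<open>Laurent sums and their remainder\<close>

text \<open>Brings the sum into the form produced by the two kernel expansions, with exponents from
  \<open>-n\<close> to \<open>n - 1\<close>. Relative to that range half of the term at
  \<open>n\<close> is missing and half of the term at \<open>-n\<close> is surplus. At
  \<open>n = 0\<close> the left side would be the constant coefficient and the right side 0.\<close>

lemma halved_laurent_sum_eq:
  assumes "0 < n" and "z \<noteq> 0"
  shows "halved_laurent_sum K n z =
     (\<Sum>j<n. laurent_coeff K (int j) * z ^ j) + (\<Sum>j<n. laurent_coeff K (- int (Suc j)) / z ^ Suc j)
       + laurent_coeff K (int n) * z ^ n / 2 - laurent_coeff K (- int n) / z ^ n / 2"
proof -
  let ?c = "laurent_coeff K"
  \<comment> \<open>With the term at \<open>-n\<close> added, the induction step gains one power at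
    each end.\<close>
  have "(\<Sum>k = - int n + 1..int n - 1. ?c k * z powi k) + ?c (- int n) / z ^ n =
     (\<Sum>j<n. ?c (int j) * z ^ j) + (\<Sum>j<n. ?c (- int (Suc j)) / z ^ Suc j)"
    using assms(1)
  proof (induction n rule: nat_induct_non_zero)
    case 1
    show ?case by simp
  next
    case (Suc n)
    have "{- int (Suc n) + 1..int (Suc n) - 1} = insert (- int n) (insert (int n) {- int n + 1..int n - 1})"
      using Suc.hyps by auto
    with Suc show ?case
      by (simp add: power_int_minus field_simps)
  qed
  then have *: "(\<Sum>k = - int n + 1..int n - 1. ?c k * z powi k) =
     (\<Sum>j<n. ?c (int j) * z ^ j) + (\<Sum>j<n. ?c (- int (Suc j)) / z ^ Suc j) - ?c (- int n) / z ^ n"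
    by (simp only: eq_diff_eq)
  have "halved_laurent_sum K n z = 1 / 2 * (?c (- int n) / z ^ n) + (\<Sum>k = - int n + 1..int n - 1. ?c k * z powi k)
      + 1 / 2 * (?c (int n) * z ^ n)"
    unfolding halved_laurent_sum_def by (simp add: power_int_minus inverse_eq_divide)
  moreover have "1 / 2 * p + (X - p) + 1 / 2 * q = X + q / 2 - p / 2" for X p q :: complex
    by (simp add: field_simps)
  ultimately show ?thesis
    unfolding * by simp
qed

text \<open>The unit circle is moved outwards for nonnegative indices and inwards for negative ones,
  which gives the coefficients of the two expansions of Cauchy transforms.\<close>

lemma laurent_coeff_eq:
  assumes "open S" and "K holomorphic_on S" and sub: "annulus r \<subseteq> S" and "1 < r"
  shows "laurent_coeff K (int j) = contour_integral (circlepath 0 r) (\<lambda>z. K z / z ^ Suc j) / (2 * of_real pi * \<i>)"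
    and "laurent_coeff K (- int (Suc j)) = contour_integral (circlepath 0 (1 / r)) (\<lambda>z. K z * z ^ j) / (2 * of_real pi * \<i>)"
proof -
  let ?C = "circlepath 0 :: real \<Rightarrow> real \<Rightarrow> complex"
  have r: "0 < 1 / r" "1 / r \<le> 1" using assms(4) by auto
  then have r': "1 / r \<le> x" if "1 \<le> x" for x using that by linarith
  have sub': "z \<in> S" if "1 / r \<le> norm z" "norm z \<le> r" for z
    using sub that by (auto simp: annulus_def inverse_eq_divide)
  have *: "z powi (- int j - 1) = 1 / z ^ Suc j" for z :: complex
  proof -
    have "z powi (- int j - 1) = z powi - int (Suc j)" by (rule arg_cong[where f = "power_int z"]) simp
    also have "\<dots> = 1 / z ^ Suc j" unfolding power_int_minus power_int_of_nat by (simp only: inverse_eq_divide)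
    finally show ?thesis .
  qed
  have "contour_integral (?C 1) (\<lambda>z. K z / z ^ Suc j) = contour_integral (?C r) (\<lambda>z. K z / z ^ Suc j)"
    using assms(1,4) r
    by (intro contour_integral_circlepath_deform[where S = "S - {0}"])
      (auto intro!: holomorphic_intros holomorphic_on_subset[OF assms(2)] sub' r')
  then show "laurent_coeff K (int j) = contour_integral (?C r) (\<lambda>z. K z / z ^ Suc j) / (2 * of_real pi * \<i>)"
    unfolding laurent_coeff_def * by simp
  have "contour_integral (?C (1 / r)) (\<lambda>z. K z * z ^ j) = contour_integral (?C 1) (\<lambda>z. K z * z ^ j)"
    using assms r by (intro contour_integral_circlepath_deform[OF assms(1)] sub' holomorphic_intros) auto
  then show "laurent_coeff K (- int (Suc j)) = contour_integral (?C (1 / r)) (\<lambda>z. K z * z ^ j) / (2 * of_real pi * \<i>)"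
    unfolding laurent_coeff_def by simp
qed

text \<open>Cauchy estimates: on \<open>norm z = r\<close> for nonnegative indices and on
  \<open>norm z = 1 / r\<close> for negative ones.\<close>

lemma norm_laurent_coeff_le:
  assumes "open S" and "K holomorphic_on S" and sub: "annulus r \<subseteq> S" and "1 < r"
    and B: "\<And>z. norm z = r \<or> norm z = 1 / r \<Longrightarrow> norm (K z) \<le> B"
  shows "norm (laurent_coeff K (int j)) \<le> B / r ^ j"
    and "norm (laurent_coeff K (- int j)) \<le> B / r ^ j"
proof -
  let ?C = "circlepath 0 :: real \<Rightarrow> real \<Rightarrow> complex"
  have r: "0 < r" "0 < 1 / r" "1 / r \<le> r" "1 / r \<le> 1"
    using assms(4) by (auto simp: divide_simps less_1_mult order.strict_implies_order)
  have cont: "continuous_on (sphere 0 \<rho>) K" if "1 / r \<le> \<rho>" "\<rho> \<le> r" for \<rho>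
    using that sub
    by (intro continuous_on_subset[OF holomorphic_on_imp_continuous_on[OF assms(2)]])
      (auto simp: annulus_def inverse_eq_divide)
  have "norm (contour_integral (?C r) (\<lambda>z. K z / z ^ Suc j)) \<le> B / r ^ Suc j * (2 * pi * r)" for j
    using r B by (intro norm_contour_integral_circlepath_le)
      (auto simp: norm_divide norm_power norm_mult intro!: continuous_intros cont divide_right_mono)
  then show *: "norm (laurent_coeff K (int j)) \<le> B / r ^ j" for j
    unfolding laurent_coeff_eq(1)[OF assms(1-4)]
    using r by (simp add: norm_divide norm_mult field_simps)
  have "norm (contour_integral (?C (1 / r)) (\<lambda>z. K z * z ^ j)) \<le> B * (1 / r) ^ j * (2 * pi * (1 / r))" for j
    using r B by (intro norm_contour_integral_circlepath_le)
      (auto simp: norm_power norm_mult intro!: continuous_intros cont mult_right_mono)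
  then have "norm (laurent_coeff K (- int (Suc j))) \<le> B / r ^ Suc j" for j
    unfolding laurent_coeff_eq(2)[OF assms(1-4)]
    using r by (simp add: norm_divide norm_mult field_simps)
  \<comment> \<open>Index 0 is not of the form \<open>- int (Suc j)\<close> and is taken from the
    first estimate.\<close>
  then show "norm (laurent_coeff K (- int j)) \<le> B / r ^ j"
    using *[of 0] by (cases j) (auto simp del: of_nat_Suc power_Suc)
qed

text \<open>Cauchy's formula in the annulus, with both transforms expanded to \<open>n\<close>
  terms. The two remainders stay separate because they will be integrated over different
  circles.\<close>

lemma laurent_remainder:
  assumes "open S" and "K holomorphic_on S" and sub: "annulus r \<subseteq> S" and "1 < r" and w: "norm w = 1"
  shows "K w = (\<Sum>j<n. laurent_coeff K (int j) * w ^ j) + (\<Sum>j<n. laurent_coeff K (- int (Suc j)) / w ^ Suc j)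
     + (w ^ n * cauchy_transform r (\<lambda>z. K z / z ^ n) w
        - cauchy_transform (1 / r) (\<lambda>z. K z * z ^ n) w / w ^ n)"
proof -
  have r: "0 < r" "0 < 1 / r" "1 / r < 1" "1 / r \<le> r"
    using assms(4) by (auto simp: divide_simps less_1_mult order.strict_implies_order)
  have sub': "z \<in> S" if "1 / r \<le> norm z" "norm z \<le> r" for z
    using sub that by (auto simp: annulus_def inverse_eq_divide)
  have cont: "continuous_on (sphere 0 \<rho>) K" if "1 / r \<le> \<rho>" "\<rho> \<le> r" for \<rho>
    using that sub' by (intro continuous_on_subset[OF holomorphic_on_imp_continuous_on[OF assms(2)]]) auto
  have "K w = cauchy_transform r K w + - cauchy_transform (1 / r) K w"
    using cauchy_formula_annulus[OF assms(1,2) r(2) sub', of r w] w assms(4) r by simp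
  also have "cauchy_transform r K w =
     (\<Sum>j<n. laurent_coeff K (int j) * w ^ j) + w ^ n * cauchy_transform r (\<lambda>z. K z / z ^ n) w"
    unfolding laurent_coeff_eq(1)[OF assms(1-4)]
    using w assms(4) r by (intro cauchy_transform_expansion_inside cont) auto
  also have "- cauchy_transform (1 / r) K w =
     (\<Sum>j<n. laurent_coeff K (- int (Suc j)) / w ^ Suc j)
       - cauchy_transform (1 / r) (\<lambda>z. K z * z ^ n) w / w ^ n"
    unfolding laurent_coeff_eq(2)[OF assms(1-4)]
    using w assms(4) r by (intro cauchy_transform_expansion_outside cont) auto
  finally show ?thesis by simp
qed

text \<open>The coefficient bounds turn the sum into geometric sums of ratio \<open>R / r\<close>,
  which exceeds 1, so the largest power dominates.\<close>

lemma norm_halved_laurent_sum_le: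
  assumes "0 < n" and "0 < r" and "r < R" and "1 \<le> R" and z: "norm z = R \<or> norm z = 1 / R"
    and c: "\<And>j. norm (laurent_coeff K (int j)) \<le> B / r ^ j" "\<And>j. norm (laurent_coeff K (- int j)) \<le> B / r ^ j"
  shows "norm (halved_laurent_sum K n z) \<le> 2 * R / (R - r) * B * (R / r) ^ n"
proof -
  let ?c = "laurent_coeff K"
  define q where "q = R / r"
  have q: "1 < q" using assms(2,3) by (simp add: q_def)
  have B: "0 \<le> B" using order_trans[OF norm_ge_zero c(1)[of 0]] by simp
  have R: "1 / R \<le> R" using assms(4) by (simp add: divide_simps mult_ge1_I)
  \<comment> \<open>On either circle both \<open>z\<close> and its inverse have modulus at most
    \<open>R\<close>, so positive and negative powers get the same bound.\<close>
  then have *: "norm z \<le> R" "inverse (norm z) \<le> R" "z \<noteq> 0" using assms(4) z by (auto simp: inverse_eq_divide)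
  have pos: "norm (?c (int j) * z ^ j) \<le> B * q ^ j" for j
  proof -
    have "norm (?c (int j) * z ^ j) \<le> B / r ^ j * R ^ j"
      unfolding norm_mult norm_power using c(1) * B assms(2) by (intro mult_mono power_mono) auto
    then show ?thesis by (simp add: q_def power_divide)
  qed
  have neg: "norm (?c (- int j) / z ^ j) \<le> B * q ^ j" for j
  proof -
    have "norm (?c (- int j) * inverse z ^ j) \<le> B / r ^ j * R ^ j"
      unfolding norm_mult norm_power norm_inverse using c(2) * B assms(2) by (intro mult_mono power_mono) auto
    then show ?thesis by (simp add: q_def divide_inverse power_inverse power_mult_distrib mult_ac)
  qed
  have gp: "(\<Sum>j<n. q ^ j) \<le> q ^ n / (q - 1)"
    using q by (simp add: sum_gp_strict divide_simps) (simp add: algebra_simps)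
  have "norm (\<Sum>j<n. ?c (int j) * z ^ j) \<le> B * (\<Sum>j<n. q ^ j)"
    unfolding sum_distrib_left by (intro sum_norm_le pos)
  also have "\<dots> \<le> B * (q ^ n / (q - 1))" by (rule mult_left_mono[OF gp B])
  finally have 1: "norm (\<Sum>j<n. ?c (int j) * z ^ j) \<le> B * (q ^ n / (q - 1))" .
  have "norm (\<Sum>j<n. ?c (- int (Suc j)) / z ^ Suc j) \<le> (\<Sum>j<n. B * q ^ Suc j)"
    by (intro sum_norm_le neg)
  also have "\<dots> = B * q * (\<Sum>j<n. q ^ j)" by (simp add: sum_distrib_left mult_ac)
  also have "\<dots> \<le> B * q * (q ^ n / (q - 1))" using B q by (intro mult_left_mono[OF gp]) auto
  finally have 2: "norm (\<Sum>j<n. ?c (- int (Suc j)) / z ^ Suc j) \<le> B * q * (q ^ n / (q - 1))" .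
  have 3: "norm (?c (int n) * z ^ n / 2) \<le> B * q ^ n / 2" using pos[of n] by (simp add: norm_divide)
  have 4: "norm (?c (- int n) / z ^ n / 2) \<le> B * q ^ n / 2" using neg[of n] by (simp add: norm_divide)
  have "norm (halved_laurent_sum K n z) \<le>
     B * (q ^ n / (q - 1)) + B * q * (q ^ n / (q - 1)) + B * q ^ n / 2 + B * q ^ n / 2"
    unfolding halved_laurent_sum_eq[OF assms(1) *(3)]
    by (rule order_trans[OF norm_triangle_ineq4 add_mono[OF norm_triangle_le[OF add_mono[OF norm_triangle_le[OF add_mono[OF 1 2]] 3]] 4]])
  \<comment> \<open>The four contributions add up to
    \<open>(1 + q) / (q - 1) + 1 = 2 * q / (q - 1)\<close>.\<close>
  also have "\<dots> = 2 * (q / (q - 1)) * B * q ^ n"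
    using q by (simp add: divide_simps) (simp add: algebra_simps)
  also have "q / (q - 1) = R / (R - r)" using assms(2,3) by (simp add: q_def divide_simps)
  finally show ?thesis by (simp add: q_def)
qed

section \<open>The integral of the Laurent remainder against u\<close>

lemma circle_int_add:
  assumes "continuous_on (sphere 0 1) f" and "continuous_on (sphere 0 1) g"
  shows "circle_int (\<lambda>z. f z + g z) = circle_int f + circle_int g"
  unfolding circle_int_def add_divide_distrib
  using assms by (intro contour_integral_add contour_integrable_continuous_circlepath)
    (auto intro!: continuous_intros)

lemma circle_int_cong:
  assumes "\<And>z. norm z = 1 \<Longrightarrow> f z = g z"
  shows "circle_int f = circle_int g"
  unfolding circle_int_def using assms by (intro contour_integral_cong) auto

text \<open>The circle may be moved in either direction, hence \<open>min\<close> and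
  \<open>max\<close>. The bound is free of \<open>\<rho>\<close> because \<open>1 / z\<close>
  cancels the length of the circle up to \<open>2 * pi\<close>.\<close>

lemma norm_circle_int_le:
  assumes "open S" and "v holomorphic_on S" and "0 < \<rho>"
    and sub: "\<And>z. min 1 \<rho> \<le> norm z \<Longrightarrow> norm z \<le> max 1 \<rho> \<Longrightarrow> z \<in> S"
    and B: "\<And>z. norm z = \<rho> \<Longrightarrow> norm (v z) \<le> B"
  shows "norm (circle_int v) \<le> 2 * pi * B"
proof -
  have hol: "(\<lambda>z. v z / (\<i> * z)) holomorphic_on S - {0}"
    by (auto intro!: holomorphic_intros holomorphic_on_subset[OF assms(2)])
  have "circle_int v = contour_integral (circlepath 0 \<rho>) (\<lambda>z. v z / (\<i> * z))"
  proof (cases "1 \<le> \<rho>")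
    case True
    then show ?thesis unfolding circle_int_def using assms(1,3)
      by (intro contour_integral_circlepath_deform[OF _ hol]) (auto intro!: sub)
  next
    case False
    then show ?thesis unfolding circle_int_def using assms(1,3)
      by (intro contour_integral_circlepath_deform[OF _ hol, symmetric]) (auto intro!: sub)
  qed
  also have "norm \<dots> \<le> B / \<rho> * (2 * pi * \<rho>)"
    using assms(3) B sub
    by (intro norm_contour_integral_circlepath_le continuous_on_subset[OF holomorphic_on_imp_continuous_on[OF hol]])
      (auto simp: norm_divide norm_mult intro!: divide_right_mono)
  finally show ?thesis using assms(3) by (simp add: mult_ac)
qed

text \<open>On the unit circle \<open>K\<close> minus its halved sum is \<open>P + N\<close>. The
  first is carried inwards to \<open>1 / R\<close>, the second outwards to \<open>R\<close>; both
  stay within the domain of \<open>u\<close>.\<close>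

lemma circle_int_laurent_remainder_le:
  assumes "0 < n" and "1 < r" and "r < R"
    and S: "open S" "K holomorphic_on S" "annulus r \<subseteq> S"
    and T: "open T" "u holomorphic_on T" "annulus R \<subseteq> T"
    and B: "\<And>z. norm z = r \<or> norm z = 1 / r \<Longrightarrow> norm (K z) \<le> B"
    and M: "\<And>z. norm z = R \<or> norm z = 1 / R \<Longrightarrow> norm (u z) \<le> M"
  shows "norm (circle_int (\<lambda>z. K z * u z) - circle_int (\<lambda>z. halved_laurent_sum K n z * u z))
     \<le> 2 * pi * B * M * (r / (r - 1 / R) + 1 / r / (R - 1 / r) + 1) / (R * r) ^ n"
proof -
  let ?c = "laurent_coeff K"
  have r: "0 < r" "1 / r < 1" "0 < 1 / r" "1 / r \<le> r" and R: "1 < R" "0 < R" "0 < 1 / R" "1 / R < 1" "1 / R < 1 / r" "1 / R < r"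
    using assms(2,3) by (auto simp: divide_simps less_1_mult order.strict_implies_order mult_strict_mono)
  have subS: "z \<in> S" if "1 / r \<le> norm z" "norm z \<le> r" for z
    using S(3) that by (auto simp: annulus_def inverse_eq_divide)
  have subT: "z \<in> T" if "1 / R \<le> norm z" "norm z \<le> R" for z
    using T(3) that by (auto simp: annulus_def inverse_eq_divide)
  have contK: "continuous_on (sphere 0 \<rho>) K" if "1 / r \<le> \<rho>" "\<rho> \<le> r" for \<rho>
    using that subS by (intro continuous_on_subset[OF holomorphic_on_imp_continuous_on[OF S(2)]]) auto
  have contu: "continuous_on (sphere 0 1) u"
    using subT R by (intro continuous_on_subset[OF holomorphic_on_imp_continuous_on[OF T(2)]]) auto
  have c: "norm (?c (int n)) \<le> B / r ^ n" "norm (?c (- int n)) \<le> B / r ^ n"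
    using norm_laurent_coeff_le[OF S assms(2) B] by auto
  have B0: "0 \<le> B" using order_trans[OF norm_ge_zero B[of "of_real r"]] r(1) by simp
  have M0: "0 \<le> M" using order_trans[OF norm_ge_zero M[of "of_real R"]] R(2) by simp
  \<comment> \<open>The half coefficients correct for the exponent range \<open>-n\<close> to
    \<open>n - 1\<close>. They fit under the factors \<open>w ^ n\<close> and
    \<open>1 / w ^ n\<close>, so the zeros of order \<open>n\<close> survive.\<close>
  define P where "P w = w ^ n * (cauchy_transform r (\<lambda>z. K z / z ^ n) w - ?c (int n) / 2)" for w
  define N where "N w = (?c (- int n) / 2 - cauchy_transform (1 / r) (\<lambda>z. K z * z ^ n) w) / w ^ n" for w
  have contP: "continuous_on (sphere 0 r) (\<lambda>z. K z / z ^ n)"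
    and contN: "continuous_on (sphere 0 (1 / r)) (\<lambda>z. K z * z ^ n)"
    using r by (auto intro!: continuous_intros contK)
  have holP: "P holomorphic_on ball 0 r"
    unfolding P_def
    by (intro holomorphic_intros holomorphic_on_subset[OF cauchy_transform_holomorphic[OF r(1) contP]]) auto
  have holN: "N holomorphic_on - cball 0 (1 / r)"
    unfolding N_def using r
    by (intro holomorphic_intros holomorphic_on_subset[OF cauchy_transform_holomorphic[OF r(3) contN]]) auto
  \<comment> \<open>\<open>w ^ n\<close> gives \<open>R\<close> to the power \<open>-n\<close>; the
    density \<open>K z / z ^ n\<close> is at most \<open>B / r ^ n\<close> on its circle, at
    distance \<open>r - 1 / R\<close> from \<open>w\<close>.\<close>
  have P_le: "norm (P w * u w) \<le> B * M * (r / (r - 1 / R) + 1 / 2) / (R * r) ^ n" if w: "norm w = 1 / R" for w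
  proof -
    have "norm (cauchy_transform r (\<lambda>z. K z / z ^ n) w) \<le> r * (B / r ^ n) / \<bar>norm w - r\<bar>"
      using B w r R by (intro norm_cauchy_transform_le contP)
        (auto simp: norm_divide norm_power intro!: divide_right_mono)
    also have "\<bar>norm w - r\<bar> = r - 1 / R" using w R by simp
    finally have 1: "norm (cauchy_transform r (\<lambda>z. K z / z ^ n) w) \<le> B / r ^ n * (r / (r - 1 / R))"
      by (simp add: mult_ac)
    have 2: "norm (?c (int n) / 2) \<le> B / r ^ n * (1 / 2)" using c(1) by (simp add: norm_divide)
    have "norm (cauchy_transform r (\<lambda>z. K z / z ^ n) w - ?c (int n) / 2) \<le> B / r ^ n * (r / (r - 1 / R) + 1 / 2)"
      unfolding distrib_left by (rule order_trans[OF norm_triangle_ineq4 add_mono[OF 1 2]])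
    then have "norm (P w * u w) \<le> ((1 / R) ^ n * (B / r ^ n * (r / (r - 1 / R) + 1 / 2))) * M"
      unfolding P_def norm_mult norm_power w using M w B0 M0 r R
      by (intro mult_mono mult_left_mono) auto
    then show ?thesis by (simp add: power_divide power_mult_distrib mult_ac)
  qed
  \<comment> \<open>Here \<open>1 / w ^ n\<close> gives the power of \<open>R\<close>, and
    \<open>z ^ n\<close> on \<open>norm z = 1 / r\<close> that of \<open>r\<close>.\<close>
  have N_le: "norm (N w * u w) \<le> B * M * (1 / r / (R - 1 / r) + 1 / 2) / (R * r) ^ n" if w: "norm w = R" for w
  proof -
    have "norm (cauchy_transform (1 / r) (\<lambda>z. K z * z ^ n) w) \<le> 1 / r * (B / r ^ n) / \<bar>norm w - 1 / r\<bar>"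
      using B w r R by (intro norm_cauchy_transform_le contN)
        (auto simp: norm_divide norm_mult norm_power power_divide intro!: divide_right_mono)
    also have "\<bar>norm w - 1 / r\<bar> = R - 1 / r" using w R(1) r(2) by linarith
    finally have 1: "norm (cauchy_transform (1 / r) (\<lambda>z. K z * z ^ n) w) \<le> B / r ^ n * (1 / r / (R - 1 / r))"
      by (simp add: mult_ac)
    have 2: "norm (?c (- int n) / 2) \<le> B / r ^ n * (1 / 2)" using c(2) by (simp add: norm_divide)
    have 3: "norm (?c (- int n) / 2 - cauchy_transform (1 / r) (\<lambda>z. K z * z ^ n) w) \<le> B / r ^ n * (1 / r / (R - 1 / r) + 1 / 2)"
      unfolding distrib_left
      by (rule order_trans[OF norm_triangle_ineq4]) (rule order_trans[OF add_mono[OF 2 1]], simp)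
    have "norm (N w * u w) \<le> B / r ^ n * (1 / r / (R - 1 / r) + 1 / 2) / R ^ n * M"
      unfolding N_def norm_mult norm_divide norm_power w
      by (rule mult_mono[OF divide_right_mono[OF 3] M divide_nonneg_nonneg[OF order_trans[OF norm_ge_zero 3]]])
        (use w R in auto)
    then show ?thesis by (simp add: power_mult_distrib mult_ac)
  qed
  have "norm (circle_int (\<lambda>z. P z * u z)) \<le> 2 * pi * (B * M * (r / (r - 1 / R) + 1 / 2) / (R * r) ^ n)"
  proof (rule norm_circle_int_le[where S = "ball 0 r \<inter> T" and \<rho> = "1 / R"])
    show "(\<lambda>z. P z * u z) holomorphic_on ball 0 r \<inter> T"
      by (intro holomorphic_intros holomorphic_on_subset[OF holP] holomorphic_on_subset[OF T(2)]) auto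
  qed (use assms(2) R T(1) P_le in \<open>auto intro!: subT\<close>)
  moreover have "norm (circle_int (\<lambda>z. N z * u z)) \<le> 2 * pi * (B * M * (1 / r / (R - 1 / r) + 1 / 2) / (R * r) ^ n)"
  proof (rule norm_circle_int_le[where S = "- cball 0 (1 / r) \<inter> T" and \<rho> = R])
    show "(\<lambda>z. N z * u z) holomorphic_on - cball 0 (1 / r) \<inter> T"
      by (intro holomorphic_intros holomorphic_on_subset[OF holN] holomorphic_on_subset[OF T(2)]) auto
    fix z :: complex assume "min 1 R \<le> norm z" "norm z \<le> max 1 R"
    then have "1 \<le> norm z" "norm z \<le> R" using R(1) by auto
    then have "1 / r < norm z" "1 / R \<le> norm z" "norm z \<le> R" using r(2) R(4) by linarith+
    then show "z \<in> - cball 0 (1 / r) \<inter> T" using subT by simp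
  qed (use R T(1) N_le in \<open>auto intro!: open_Int\<close>)
  moreover have "circle_int (\<lambda>z. K z * u z) =
      circle_int (\<lambda>z. halved_laurent_sum K n z * u z) + (circle_int (\<lambda>z. P z * u z) + circle_int (\<lambda>z. N z * u z))"
  proof -
    have "circle_int (\<lambda>z. K z * u z) = circle_int (\<lambda>z. halved_laurent_sum K n z * u z + (P z * u z + N z * u z))"
    proof (rule circle_int_cong)
      fix z :: complex assume z: "norm z = 1"
      then have "z \<noteq> 0" by auto
      have "K z = halved_laurent_sum K n z + (P z + N z)"
        unfolding halved_laurent_sum_eq[OF assms(1) \<open>z \<noteq> 0\<close>] P_def N_def
        by (subst laurent_remainder[OF S assms(2) z, of n]) (simp add: right_diff_distrib diff_divide_distrib mult_ac)
      then show "K z * u z = halved_laurent_sum K n z * u z + (P z * u z + N z * u z)"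
        by (simp add: distrib_right)
    qed
    also have "\<dots> = circle_int (\<lambda>z. halved_laurent_sum K n z * u z) + circle_int (\<lambda>z. P z * u z + N z * u z)"
      unfolding halved_laurent_sum_def using assms(2) r
      by (intro circle_int_add continuous_intros contu
          continuous_on_subset[OF holomorphic_on_imp_continuous_on[OF holP]]
          continuous_on_subset[OF holomorphic_on_imp_continuous_on[OF holN]]) auto
    also have "circle_int (\<lambda>z. P z * u z + N z * u z) = circle_int (\<lambda>z. P z * u z) + circle_int (\<lambda>z. N z * u z)"
      using assms(2) r
      by (intro circle_int_add continuous_intros contu
          continuous_on_subset[OF holomorphic_on_imp_continuous_on[OF holP]]
          continuous_on_subset[OF holomorphic_on_imp_continuous_on[OF holN]]) auto
    finally show ?thesis .
  qed
  ultimately have "norm (circle_int (\<lambda>z. K z * u z) - circle_int (\<lambda>z. halved_laurent_sum K n z * u z)) \<le>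
      2 * pi * (B * M * (r / (r - 1 / R) + 1 / 2) / (R * r) ^ n) + 2 * pi * (B * M * (1 / r / (R - 1 / r) + 1 / 2) / (R * r) ^ n)"
    by (simp add: norm_triangle_le)
  also have "\<dots> = 2 * pi * B * M * ((r / (r - 1 / R) + 1 / 2) + (1 / r / (R - 1 / r) + 1 / 2)) / (R * r) ^ n"
    by (simp only: distrib_left add_divide_distrib mult.assoc times_divide_eq_right)
  \<comment> \<open>The two halves from the extreme coefficients make the summand 1.\<close>
  finally show ?thesis by (simp only: add.assoc add.left_commute[of "1 / 2"] field_sum_of_halves)
qed

section \<open>Combining the two error terms\<close>

text \<open>The bound comes from compactness of the two boundary circles. It is applied to
  \<open>u\<close> and to \<open>K\<close>, each with its own radius.\<close>

lemma analytic_on_annulus_bounded: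
  assumes "f analytic_on annulus \<rho>" and "1 < \<rho>"
  obtains S B where "open S" "f holomorphic_on S" "annulus \<rho> \<subseteq> S"
    and "\<And>z. norm z = \<rho> \<or> norm z = 1 / \<rho> \<Longrightarrow> norm (f z) \<le> B"
proof -
  obtain S where S: "open S" "annulus \<rho> \<subseteq> S" "f holomorphic_on S"
    using assms(1) by (auto simp: analytic_on_holomorphic)
  have "1 / \<rho> \<le> \<rho>" using assms(2) by (simp add: divide_simps mult_ge1_I)
  then have "sphere 0 \<rho> \<union> sphere 0 (1 / \<rho>) \<subseteq> S"
    using S(2) by (auto simp: annulus_def inverse_eq_divide)
  then have "compact (f ` (sphere 0 \<rho> \<union> sphere 0 (1 / \<rho>)))"
    by (intro compact_continuous_image compact_Un
        continuous_on_subset[OF holomorphic_on_imp_continuous_on[OF S(3)]]) auto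
  then obtain B where "\<forall>y \<in> f ` (sphere 0 \<rho> \<union> sphere 0 (1 / \<rho>)). norm y \<le> B"
    using compact_imp_bounded bounded_iff by metis
  then show thesis using S by (intro that[of S B]) auto
qed

theorem theorem2p2:
  fixes r R :: real and u K :: "complex \<Rightarrow> complex"
  assumes "1 < r" and "r < R"
    and "u analytic_on annulus R"
    and "K analytic_on annulus r"
  shows "(\<lambda>n. trapezoid (2 * n) (\<lambda>z. halved_laurent_sum K n z * u z) - circle_int (\<lambda>z. K z * u z))
           \<in> O(\<lambda>n. complex_of_real ((R * r) powi (- int n)))"
proof -
  have R: "1 < R" "0 < R" "0 < r" using assms(1,2) by auto
  obtain T M where T: "open T" "u holomorphic_on T" "annulus R \<subseteq> T"
    and M: "\<And>z. norm z = R \<or> norm z = 1 / R \<Longrightarrow> norm (u z) \<le> M"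
    using analytic_on_annulus_bounded[OF assms(3) R(1)] by metis
  obtain S B where S: "open S" "K holomorphic_on S" "annulus r \<subseteq> S"
    and B: "\<And>z. norm z = r \<or> norm z = 1 / r \<Longrightarrow> norm (K z) \<le> B"
    using analytic_on_annulus_bounded[OF assms(4,1)] by metis
  have B0: "0 \<le> B" using order_trans[OF norm_ge_zero B[of "of_real r"]] R(3) by simp
  have M0: "0 \<le> M" using order_trans[OF norm_ge_zero M[of "of_real R"]] R(2) by simp
  define A where "A = 2 * R / (R - r) * B * M"
  define D where "D = 2 * pi * B * M * (r / (r - 1 / R) + 1 / r / (R - 1 / r) + 1)"
  have A0: "0 \<le> A" using B0 M0 assms(2) R by (simp add: A_def)
  show ?thesis
  proof (rule bigoI[where c = "4 * pi * A * (R / (R - 1)) + D"], rule eventually_mono[OF eventually_gt_at_top[of 0]])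
    fix n :: nat assume n: "0 < n"
    let ?v = "\<lambda>z. halved_laurent_sum K n z * u z"
    have v: "norm (?v z) \<le> A * (R / r) ^ n" if z: "norm z = R \<or> norm z = 1 / R" for z
    proof -
      have "norm (?v z) \<le> 2 * R / (R - r) * B * (R / r) ^ n * M"
        unfolding norm_mult using R assms(2) B0 M0 n z
        by (intro mult_mono M norm_halved_laurent_sum_le norm_laurent_coeff_le[OF S assms(1) B]) auto
      then show ?thesis by (simp add: A_def mult_ac)
    qed
    \<comment> \<open>The halved sum is a Laurent polynomial, so the product is holomorphic wherever
      \<open>u\<close> is, except possibly at 0; the domain of \<open>K\<close> does not restrict
      it.\<close>
    have "?v holomorphic_on T - {0}"
      unfolding halved_laurent_sum_def
      by (intro holomorphic_intros holomorphic_on_subset[OF T(2)]) auto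
    moreover have "annulus R \<subseteq> T - {0}" using T(3) R by (auto simp: annulus_def)
    ultimately have "norm (trapezoid (2 * n) ?v - circle_int ?v) \<le> 4 * pi * (A * (R / r) ^ n) / (R ^ (2 * n) - 1)"
      using n R T(1) by (intro trapezoid_error_le[where S = "T - {0}"] v) auto
    \<comment> \<open>Since \<open>R \<le> R ^ (2 * n)\<close>, the subtracted 1 is at most
      \<open>R ^ (2 * n) / R\<close>; this leaves a pure power with a constant independent of
      \<open>n\<close>.\<close>
    also have "\<dots> \<le> 4 * pi * (A * (R / r) ^ n) / (R ^ (2 * n) * ((R - 1) / R))"
    proof (intro divide_left_mono mult_pos_pos)
      have "R ^ 1 \<le> R ^ (2 * n)" using R n by (intro power_increasing) auto
      then show "R ^ (2 * n) * ((R - 1) / R) \<le> R ^ (2 * n) - 1" using R by (simp add: field_simps)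
    next
      show "0 < R ^ (2 * n) - 1" using R n by (simp add: one_less_power)
    qed (use R A0 in auto)
    \<comment> \<open>The doubled number of nodes pays for the growth on the outer circles:
      \<open>(R / r) ^ n / R ^ (2 * n) = 1 / (R * r) ^ n\<close>.\<close>
    also have "\<dots> = 4 * pi * A * (R / (R - 1)) / (R * r) ^ n"
      using R by (simp add: power_mult_distrib power_divide power_mult power2_eq_square field_simps)
    finally have 1: "norm (trapezoid (2 * n) ?v - circle_int ?v) \<le> 4 * pi * A * (R / (R - 1)) / (R * r) ^ n" .
    have 2: "norm (circle_int (\<lambda>z. K z * u z) - circle_int ?v) \<le> D / (R * r) ^ n"
      unfolding D_def by (rule circle_int_laurent_remainder_le[OF n assms(1,2) S T B M])
    have "norm (trapezoid (2 * n) ?v - circle_int (\<lambda>z. K z * u z))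
        = norm ((trapezoid (2 * n) ?v - circle_int ?v) - (circle_int (\<lambda>z. K z * u z) - circle_int ?v))"
      by simp
    also have "\<dots> \<le> (4 * pi * A * (R / (R - 1)) + D) * (1 / (R * r) ^ n)"
      using order_trans[OF norm_triangle_ineq4 add_mono[OF 1 2]] by (simp only: add_divide_distrib times_divide_eq_right mult_1_right)
    also have "1 / (R * r) ^ n = norm (complex_of_real ((R * r) powi (- int n)))"
      unfolding norm_of_real using R by (simp add: power_int_minus inverse_eq_divide abs_mult)
    finally show "norm (trapezoid (2 * n) ?v - circle_int (\<lambda>z. K z * u z))
      \<le> (4 * pi * A * (R / (R - 1)) + D) * norm (complex_of_real ((R * r) powi (- int n)))" .
  qed
qed

end
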